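(* For every nonnegative integer $n$, let $LG_1(n)$ denote the number of partitions of $n$ in which any two consecutive parts differ by at least $2$, and by at least $4$ if both are odd. Let $LG'_{-1}(n)$ denote the number of signed partitions of $n$ in which the positive parts are distinct and even, and the negative parts are distinct, congruent to $1 \pmod 4$, and each at most $2\ell^+$, where $\ell^+$ is the number of positive parts. Then $LG_1(n)=LG'_{-1}(n)$ for all $n\ge 0$.
   Context: A partition of an integer $n$ is a finite nonincreasing sequence of positive integers (its parts) summing to $n$. A signed partition of an integer $n$ is a pair $(\pi,\nu)$ of ordinary partitions with $|\pi|-|\nu|=n$, where $|\cdot|$ denotes the sum of parts; the parts of $\pi$ are the positive parts and the parts of $\nu$ are the negative parts (their sizes). $\ell^+$ denotes the number of positive parts of a signed partition. *)

theory Defs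
  imports Main
begin

definition is_partition :: "nat list \<Rightarrow> bool" where
  "is_partition xs \<longleftrightarrow> sorted_wrt (\<ge>) xs \<and> (\<forall>x \<in> set xs. x > 0)"

definition partition_of :: "nat \<Rightarrow> nat list \<Rightarrow> bool" where
  "partition_of n xs \<longleftrightarrow> is_partition xs \<and> sum_list xs = n"

(* The negative parts are recorded by their sizes, so both components are ordinary partitions. *)
definition signed_partition_of :: "int \<Rightarrow> nat list \<times> nat list \<Rightarrow> bool" where
  "signed_partition_of n = (\<lambda>(\<pi>, \<nu>).
     is_partition \<pi> \<and> is_partition \<nu> \<and> int (sum_list \<pi>) - int (sum_list \<nu>) = n)"

(* Differences are written additively to avoid truncated subtraction on nat. *)
definition LG_1 :: "nat \<Rightarrow> nat" where
  "LG_1 n = card {xs. partition_of n xs \<and>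
     (\<forall>i. Suc i < length xs \<longrightarrow>
        xs ! i \<ge> xs ! Suc i + 2 \<and>
        (odd (xs ! i) \<and> odd (xs ! Suc i) \<longrightarrow> xs ! i \<ge> xs ! Suc i + 4))}"

(* The set below is finite: k distinct even positive parts sum to at least k * (k + 1), while
   the distinct negative parts that are 1 mod 4 and at most 2 * k sum to at most k * (k + 1) / 2,
   so n bounds k.  Hence card is the true count. *)
definition LG'_minus_1 :: "nat \<Rightarrow> nat" where
  "LG'_minus_1 n = card {(\<pi>, \<nu>). signed_partition_of (int n) (\<pi>, \<nu>) \<and>
     distinct \<pi> \<and> (\<forall>x \<in> set \<pi>. even x) \<and>
     distinct \<nu> \<and> (\<forall>y \<in> set \<nu>. y mod 4 = 1 \<and> y \<le> 2 * length \<pi>)}"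

end

theory Submission
  imports Defs "HOL-Computational_Algebra.Formal_Power_Series"
begin

text \<open>
  Let \<open>F(x)\<close> be the generating function of the partitions counted by \<open>LG_1\<close>, with \<open>x\<close> marking the
  odd parts and \<open>q\<close> the size, and let \<open>G(x)\<close> be that of the signed partitions, with \<open>x\<close> marking
  the negative parts. Both satisfy \<open>f(x) = (1 + x q) f(x q\<^sup>4)\<close>, so each is determined by its value
  at \<open>x = 0\<close>, and at \<open>x = 0\<close> both count partitions into distinct even parts.

  Subtracting \<open>2\<close> from every (positive) part, and deleting a smallest part \<open>1\<close> or \<open>2\<close>, gives
  recurrences in the number \<open>k\<close> of (positive) parts. For the summands \<open>F\<^sub>k\<close>, \<open>G\<^sub>k\<close> with exactly
  \<open>k\<close> parts, and \<open>H\<^sub>k\<close> counting those partitions in \<open>F\<^sub>k\<close> without a part \<open>1\<close>, the functional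
  equation then holds for partial sums up to one explicit term of large \<open>q\<close>-order:
  \<open>\<Sum>\<^sub>k\<^sub>\<le>\<^sub>K F\<^sub>k(x) + x q\<^sup>2\<^sup>K\<^sup>+\<^sup>1 H\<^sub>K(x) = (1 + x q) \<Sum>\<^sub>k\<^sub>\<le>\<^sub>K F\<^sub>k(x q\<^sup>4)\<close> and
  \<open>\<Sum>\<^sub>k\<^sub>\<le>\<^sub>2\<^sub>M G\<^sub>k(x) + x q G\<^sub>2\<^sub>M(x) = (1 + x q) \<Sum>\<^sub>k\<^sub>\<le>\<^sub>2\<^sub>M G\<^sub>k(x q\<^sup>4)\<close>.
\<close>

section \<open>Adding two to every part\<close>

definition lift2 :: "nat list \<Rightarrow> nat list" where "lift2 = map (\<lambda>x. x + 2)"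

lemma lift2_obtain:
  assumes "\<And>x. x \<in> set xs \<Longrightarrow> x \<ge> 2"
  obtains ys where "xs = lift2 ys"
proof
  show "xs = lift2 (map (\<lambda>x. x - 2) xs)"
    unfolding lift2_def using assms by (induction xs) fastforce+
qed

lemma inj_lift2: "inj lift2"
  unfolding lift2_def by (simp add: inj_on_def)

lemma lift2_eq_iff [simp]: "lift2 xs = lift2 ys \<longleftrightarrow> xs = ys"
  using inj_lift2 by (auto dest: injD)

lemma length_lift2[simp]: "length (lift2 xs) = length xs" by (simp add: lift2_def)

lemma sum_lift2[simp]: "sum_list (lift2 xs) = sum_list xs + 2 * length xs"
  by (induction xs) (auto simp: lift2_def)

lemma set_lift2: "set (lift2 xs) = (\<lambda>x. x + 2) ` set xs" by (simp add: lift2_def)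

section \<open>Signed partitions\<close>

definition signed_pair :: "nat list \<Rightarrow> nat list \<Rightarrow> bool" where
  "signed_pair \<pi> \<nu> \<longleftrightarrow> sorted_wrt (>) \<pi> \<and> (\<forall>x\<in>set \<pi>. even x \<and> x > 0) \<and>
     sorted_wrt (>) \<nu> \<and> (\<forall>y\<in>set \<nu>. y mod 4 = 1 \<and> y \<le> 2 * length \<pi>)"

text \<open>Positivity has to be asked of \<open>xs\<close> separately, since a part 0 would be
  lifted to the admissible part 2. The bound on the negative parts survives because lifting keeps
  the number of positive parts.\<close>

lemma signed_pair_lift2: "(\<forall>x\<in>set xs. x > 0) \<and> signed_pair (lift2 xs) \<nu> \<longleftrightarrow> signed_pair xs \<nu>"
  by (auto simp: signed_pair_def sorted_wrt_map set_lift2, auto simp: lift2_def sorted_wrt_map)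

text \<open>Subtracting 2 from all positive parts works unless the smallest is 2, which is then
  deleted first. Deletion lowers the bound on negative parts from 2k+2 to 2k; the only candidate
  congruent to 1 mod 4 in between is 2k+1, for even k, and it has to go too if present.\<close>

lemma signed_pair_cases:
  assumes "signed_pair \<pi> \<nu>" "length \<pi> = Suc k"
  obtains (shift) \<pi>' where "\<pi> = lift2 \<pi>'" "signed_pair \<pi>' \<nu>" "length \<pi>' = Suc k"
  | (two) \<pi>' where "\<pi> = lift2 \<pi>' @ [2]" "signed_pair \<pi>' \<nu>" "length \<pi>' = k"
  | (two_neg) \<pi>' \<nu>' where "\<pi> = lift2 \<pi>' @ [2]" "\<nu> = Suc (2*k) # \<nu>'" "even k"
      "signed_pair \<pi>' \<nu>'" "length \<pi>' = k"
proof -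
  obtain \<rho> a where \<rho>: "\<pi> = \<rho> @ [a]"
    using assms(2) by (metis append_butlast_last_id list.size(3) nat.distinct(1))
  have big: "x > a" if "x \<in> set \<rho>" for x
    using assms(1) that by (auto simp: signed_pair_def \<rho> sorted_wrt_append)
  have ev: "even x \<and> x > 0" if "x \<in> set \<pi>" for x
    using assms(1) that by (auto simp: signed_pair_def)
  have a: "even a" "a > 0" using ev[of a] \<rho> by auto
  show ?thesis
  proof (cases "a = 2")
    case False
    hence a4: "a > 2" using a by presburger
    have gt: "x > 2" if "x \<in> set \<pi>" for x using that \<rho> big[of x] a4 by auto
    obtain \<pi>' where p: "\<pi> = lift2 \<pi>'"
      using lift2_obtain[of \<pi>] gt by (metis less_imp_le)
    have "\<forall>x\<in>set \<pi>'. x > 0" using gt by (fastforce simp: p set_lift2)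
    hence "signed_pair \<pi>' \<nu>" using assms(1) p signed_pair_lift2 by blast
    thus ?thesis using shift p assms(2) by simp
  next
    case True
    have gt: "x > 2" if "x \<in> set \<rho>" for x using that big[of x] True by auto
    obtain \<pi>' where p: "\<rho> = lift2 \<pi>'"
      using lift2_obtain[of \<rho>] gt by (metis less_imp_le)
    have l: "length \<pi>' = k" using assms(2) \<rho> p by simp
    have pos: "\<forall>x\<in>set \<pi>'. x > 0" using gt by (fastforce simp: p set_lift2)
    have w: "sorted_wrt (>) \<pi>' \<and> (\<forall>x\<in>set \<pi>'. even x \<and> x > 0)"
      using assms(1) pos unfolding signed_pair_def \<rho> p by (auto simp: sorted_wrt_append lift2_def sorted_wrt_map)
    have n: "sorted_wrt (>) \<nu>" "\<And>y. y \<in> set \<nu> \<Longrightarrow> y mod 4 = 1 \<and> y \<le> 2 * Suc k"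
      using assms unfolding signed_pair_def by auto
    have le: "y \<le> 2*k \<or> y = Suc (2*k) \<and> even k" if "y \<in> set \<nu>" for y
      using n(2)[OF that] by presburger
    show ?thesis
    proof (cases "Suc (2*k) \<in> set \<nu>")
      case False
      hence "signed_pair \<pi>' \<nu>" using w n le l unfolding signed_pair_def by (metis)
      thus ?thesis using two p \<rho> True l by simp
    next
      case T: True
      then obtain b \<nu>' where b: "\<nu> = b # \<nu>'" by (cases \<nu>) auto
      \<comment> \<open>The sequence strictly decreases and no entry exceeds 2k+1, so this part
        stands first.\<close>
      have "b = Suc (2*k)" using T n(1) le[of b] unfolding b by auto
      moreover from this have "signed_pair \<pi>' \<nu>'"
        using w n le l unfolding signed_pair_def b by fastforce
      moreover have "even k" using le[OF T] by simp
      ultimately show ?thesis using two_neg[of \<pi>' \<nu>'] p \<rho> True l b by auto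
    qed
  qed
qed

lemma signed_pair_two: "signed_pair \<pi> \<nu> \<Longrightarrow> signed_pair (lift2 \<pi> @ [2]) \<nu>"
  by (fastforce simp: signed_pair_def lift2_def sorted_wrt_append sorted_wrt_map)

lemma signed_pair_two_neg:
  "signed_pair \<pi> \<nu> \<Longrightarrow> even (length \<pi>) \<Longrightarrow>
    signed_pair (lift2 \<pi> @ [2]) (Suc (2 * length \<pi>) # \<nu>)"
proof -
  assume a: "signed_pair \<pi> \<nu>" "even (length \<pi>)"
  have "Suc (2 * length \<pi>) mod 4 = 1" using a(2) by presburger
  thus ?thesis using a by (fastforce simp: signed_pair_def lift2_def sorted_wrt_append sorted_wrt_map)
qed

text \<open>Every case of \<open>signed_pair_cases\<close> preserves both bounds; a new negative
  part is the tight case, adding 2k+2 to each side of the first. Hence the size bounds the number of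
  positive parts, and with it that of negative parts.\<close>

lemma signed_pair_bounds:
  assumes "signed_pair \<pi> \<nu>"
  shows "sum_list \<nu> + length \<pi> \<le> sum_list \<pi> \<and> length \<nu> \<le> length \<pi>"
  using assms
proof (induction "sum_list \<pi>" arbitrary: \<pi> \<nu> rule: less_induct)
  case less
  show ?case
  proof (cases "length \<pi>")
    case 0
    hence "\<nu> = []" using less.prems unfolding signed_pair_def by (cases \<nu>) auto
    thus ?thesis using 0 by simp
  next
    case (Suc k)
    from less.prems Suc show ?thesis
    proof (cases rule: signed_pair_cases)
      case (shift \<pi>') with less.hyps[of \<pi>' \<nu>] show ?thesis by simp
    next
      case (two \<pi>') with less.hyps[of \<pi>' \<nu>] show ?thesis by simp
    next
      case (two_neg \<pi>' \<nu>') with less.hyps[of \<pi>' \<nu>'] show ?thesis by simp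
    qed
  qed
qed

definition signed_set :: "nat \<Rightarrow> nat \<Rightarrow> int \<Rightarrow> (nat list \<times> nat list) set" where
  "signed_set k m n = {(\<pi>, \<nu>). signed_pair \<pi> \<nu> \<and> length \<pi> = k \<and> length \<nu> = m \<and>
     int (sum_list \<pi>) - int (sum_list \<nu>) = n}"

text \<open>The \<open>m\<close> negative parts are at most 2k, so finitely many
  \<open>\<nu>\<close> occur, and each of them fixes the sum of \<open>\<pi>\<close>.\<close>

lemma finite_signed_set: "finite (signed_set k m n)"
proof -
  define N where "N = {\<nu>. set \<nu> \<subseteq> {..2*k} \<and> length \<nu> = m}"
  have "finite N" unfolding N_def by (intro finite_lists_length_eq) auto
  moreover have "signed_set k m n \<subseteq> (\<Union>\<nu>\<in>N. {\<pi>. set \<pi> \<subseteq> {..nat (n + int (sum_list \<nu>))} \<and> length \<pi> = k} \<times> {\<nu>})"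
    by (force simp: signed_set_def signed_pair_def N_def intro!: member_le_sum_list)
  ultimately show ?thesis
    by - (rule finite_subset, assumption, auto intro!: finite_lists_length_eq)
qed

lemma signed_set_empty: "n < int k \<Longrightarrow> signed_set k m n = {}"
  by (auto simp: signed_set_def dest: signed_pair_bounds)

lemma signed_set_0: "signed_set 0 m n = (if m = 0 \<and> n = 0 then {([], [])} else {})"
proof -
  have "signed_pair [] \<nu> \<longleftrightarrow> \<nu> = []"
    for \<nu> by (cases \<nu>) (auto simp: signed_pair_def)
  thus ?thesis by (auto simp: signed_set_def)
qed

text \<open>One image for each case of \<open>signed_pair_cases\<close>. The positive parts lose
  2k+2 each time; in the third image the removed negative part 2k+1 gives back all but 1.\<close>

lemma signed_set_Suc:
  "signed_set (Suc k) m n =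
     (\<lambda>(\<pi>, \<nu>). (lift2 \<pi>, \<nu>)) ` signed_set (Suc k) m (n - int (2 * k + 2)) \<union>
     ((\<lambda>(\<pi>, \<nu>). (lift2 \<pi> @ [2], \<nu>)) ` signed_set k m (n - int (2 * k + 2)) \<union>
     (if even k \<and> m > 0 then (\<lambda>(\<pi>, \<nu>). (lift2 \<pi> @ [2], Suc (2 * k) # \<nu>)) ` signed_set k (m - 1) (n - 1) else {}))"
  (is "_ = ?A \<union> (?B \<union> ?C)")
proof
  show "signed_set (Suc k) m n \<subseteq> ?A \<union> (?B \<union> ?C)"
  proof
    fix p assume "p \<in> signed_set (Suc k) m n"
    then obtain \<pi> \<nu> where p: "p = (\<pi>, \<nu>)" and ok: "signed_pair \<pi> \<nu>" and l: "length \<pi> = Suc k"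
      and m: "length \<nu> = m" and n: "int (sum_list \<pi>) - int (sum_list \<nu>) = n"
      by (auto simp: signed_set_def)
    from ok l show "p \<in> ?A \<union> (?B \<union> ?C)"
    proof (cases rule: signed_pair_cases)
      case (shift \<pi>')
      hence "(\<pi>', \<nu>) \<in> signed_set (Suc k) m (n - int (2 * k + 2))"
        using m n by (auto simp: signed_set_def)
      thus ?thesis using shift p by force
    next
      case (two \<pi>')
      hence "(\<pi>', \<nu>) \<in> signed_set k m (n - int (2 * k + 2))"
        using m n by (auto simp: signed_set_def)
      thus ?thesis using two p by force
    next
      case (two_neg \<pi>' \<nu>')
      hence "(\<pi>', \<nu>') \<in> signed_set k (m - 1) (n - 1)" "m > 0"
        using m n by (auto simp: signed_set_def)
      thus ?thesis using two_neg p by force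
    qed
  qed
next
  have "signed_pair (lift2 \<pi>) \<nu>" if "signed_pair \<pi> \<nu>"
    for \<pi> \<nu> using that signed_pair_lift2 by blast
  thus "?A \<union> (?B \<union> ?C) \<subseteq> signed_set (Suc k) m n"
    by (auto simp: signed_set_def signed_pair_two signed_pair_two_neg split: if_splits)
qed

lemma card_signed_set_Suc:
  "card (signed_set (Suc k) m n) =
     card (signed_set (Suc k) m (n - int (2 * k + 2))) + card (signed_set k m (n - int (2 * k + 2))) +
     (if even k \<and> m > 0 then card (signed_set k (m - 1) (n - 1)) else 0)"
proof -
  let ?f = "\<lambda>(\<pi>, \<nu>). (lift2 \<pi>, \<nu>)" and ?g = "\<lambda>(\<pi>, \<nu>). (lift2 \<pi> @ [2], \<nu>)"
    and ?h = "\<lambda>(\<pi>, \<nu>). (lift2 \<pi> @ [2], Suc (2 * k) # \<nu>)"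
  define A where "A = ?f ` signed_set (Suc k) m (n - int (2 * k + 2))"
  define B where "B = ?g ` signed_set k m (n - int (2 * k + 2))"
  define C where "C = (if even k \<and> m > 0 then ?h ` signed_set k (m - 1) (n - 1) else {})"
  have fin: "finite A" "finite B" "finite C" by (auto simp: A_def B_def C_def finite_signed_set)
  \<comment> \<open>Lifted positive parts exceed 2, so the part 2 separates the first image from the
    other two.\<close>
  have "2 \<notin> set (fst p)" if "p \<in> A" for p
    using that by (force simp: A_def signed_set_def signed_pair_def set_lift2)
  moreover have "2 \<in> set (fst p)" if "p \<in> B \<union> C" for p
    using that by (auto simp: B_def C_def split: if_splits)
  ultimately have AB: "A \<inter> (B \<union> C) = {}" by blast
  \<comment> \<open>A pair with k positive parts has no negative part above 2k, which separates the
    second image from the third.\<close>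
  have "Suc (2 * k) \<notin> set (snd p)" if "p \<in> B" for p
    using that by (force simp: B_def signed_set_def signed_pair_def)
  moreover have "Suc (2 * k) \<in> set (snd p)" if "p \<in> C" for p
    using that by (auto simp: C_def split: if_splits)
  ultimately have BC: "B \<inter> C = {}" by blast
  have "card (signed_set (Suc k) m n) = card (A \<union> (B \<union> C))"
    unfolding A_def B_def C_def by (rule arg_cong[OF signed_set_Suc])
  also have "\<dots> = card A + (card B + card C)"
    using fin AB BC by (simp add: card_Un_disjoint)
  also have "card A = card (signed_set (Suc k) m (n - int (2 * k + 2)))"
    unfolding A_def by (intro card_image) (auto simp: inj_on_def)
  also have "card B = card (signed_set k m (n - int (2 * k + 2)))"
    unfolding B_def by (intro card_image) (auto simp: inj_on_def)
  also have "card C = (if even k \<and> m > 0 then card (signed_set k (m - 1) (n - 1)) else 0)"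
    unfolding C_def by (auto intro!: card_image simp: inj_on_def)
  finally show ?thesis by simp
qed

section \<open>Partitions with gap conditions\<close>

text \<open>The relation is transitive, so \<open>sorted_wrt\<close> may demand it of all pairs
  without strengthening the condition on neighbours.\<close>

definition gap_rel :: "nat \<Rightarrow> nat \<Rightarrow> bool" where
  "gap_rel a b \<longleftrightarrow> a \<ge> b + 2 \<and> (odd a \<and> odd b \<longrightarrow> a \<ge> b + 4)"

text \<open>The threshold \<open>b = 0\<close> belongs to the \<open>F\<close> and
  \<open>b = 1\<close> to the \<open>H\<close> of the overview; 2 and 3 arise in between and are
  lowered again.\<close>

definition gap_set :: "nat \<Rightarrow> nat \<Rightarrow> nat \<Rightarrow> int \<Rightarrow> nat list set" where
  "gap_set b k m n = {xs. sorted_wrt gap_rel xs \<and> (\<forall>x\<in>set xs. x > b) \<and> length xs = k \<and>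
     length (filter odd xs) = m \<and> int (sum_list xs) = n}"

lemma finite_gap_set: "finite (gap_set b k m n)"
proof -
  have "gap_set b k m n \<subseteq> {xs. set xs \<subseteq> {..nat n} \<and> length xs = k}"
    by (auto simp: gap_set_def intro!: member_le_sum_list)
  thus ?thesis by (rule finite_subset) (auto intro!: finite_lists_length_eq)
qed

lemma gap_set_empty: "n < 0 \<Longrightarrow> gap_set b k m n = {}" by (auto simp: gap_set_def)

lemma gap_set_0: "gap_set b 0 m n = (if m = 0 \<and> n = 0 then {[]} else {})"
  by (auto simp: gap_set_def)

lemma gap_rel_lift: "gap_rel (a + 2) (b + 2) \<longleftrightarrow> gap_rel a b"
  by (auto simp: gap_rel_def)

lemma lift2_mem_gap_set:
  "lift2 xs \<in> gap_set (b + 2) k m n \<longleftrightarrow> xs \<in> gap_set b k m (n - int (2 * k))"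
proof -
  have "filter odd (lift2 xs) = lift2 (filter odd xs)" by (auto simp: lift2_def filter_map o_def)
  moreover have "sorted_wrt gap_rel (lift2 xs) \<longleftrightarrow> sorted_wrt gap_rel xs"
    unfolding lift2_def sorted_wrt_map gap_rel_lift ..
  ultimately show ?thesis by (auto simp: gap_set_def set_lift2)
qed

text \<open>Adding 2 keeps differences and parities and raises the threshold by 2.\<close>

lemma gap_set_lift: "gap_set (b + 2) k m n = lift2 ` gap_set b k m (n - int (2 * k))"
proof -
  have "xs \<in> lift2 ` gap_set b k m (n - int (2 * k))" if "xs \<in> gap_set (b + 2) k m n" for xs
  proof -
    have "x \<ge> 2" if "x \<in> set xs" for x
      using that \<open>xs \<in> _\<close> by (force simp: gap_set_def)
    then obtain ys where ys: "xs = lift2 ys" using lift2_obtain by blast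
    with that show ?thesis by (simp only: lift2_mem_gap_set imageI)
  qed
  moreover have "lift2 ` gap_set b k m (n - int (2 * k)) \<subseteq> gap_set (b + 2) k m n"
    unfolding image_subset_iff lift2_mem_gap_set by simp
  ultimately show ?thesis by blast
qed

lemma card_gap_set_lift: "card (gap_set (b + 2) k m n) = card (gap_set b k m (n - int (2 * k)))"
  unfolding gap_set_lift by (intro card_image) (auto simp: inj_on_def)

text \<open>The split is by whether b+1 is a part. If b+1 is even, the other parts are at least b+3.
  If it is odd, b+3 is odd as well and too close, so they exceed b+3, and one odd part is
  removed.\<close>

lemma gap_set_split:
  "gap_set b (Suc k) m n = gap_set (Suc b) (Suc k) m n \<union>
     (if odd b then (\<lambda>xs. xs @ [Suc b]) ` gap_set (b + 2) k m (n - int (Suc b))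
      else if m > 0 then (\<lambda>xs. xs @ [Suc b]) ` gap_set (b + 3) k (m - 1) (n - int (Suc b)) else {})"
  (is "_ = ?A \<union> ?B")
proof
  show "gap_set b (Suc k) m n \<subseteq> ?A \<union> ?B"
  proof
    fix xs assume xs: "xs \<in> gap_set b (Suc k) m n"
    then obtain ys a where ys: "xs = ys @ [a]"
      by (cases xs rule: rev_cases) (auto simp: gap_set_def)
    show "xs \<in> ?A \<union> ?B"
    proof (cases "a = Suc b")
      case False
      hence "a > Suc b" using xs by (auto simp: gap_set_def ys)
      moreover from this have "\<forall>x\<in>set ys. x > Suc b"
        using xs by (fastforce simp: gap_set_def ys sorted_wrt_append gap_rel_def)
      ultimately have "xs \<in> ?A" using xs by (auto simp: gap_set_def ys)
      thus ?thesis ..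
    next
      case True
      have g: "gap_rel x (Suc b)" if "x \<in> set ys" for x
        using xs that by (auto simp: gap_set_def ys True sorted_wrt_append)
      show ?thesis
      proof (cases "odd b")
        case o: True
        have "ys \<in> gap_set (b + 2) k m (n - int (Suc b))"
          using xs g o by (fastforce simp: gap_set_def ys True sorted_wrt_append gap_rel_def)
        thus ?thesis using o ys True by auto
      next
        case o: False
        have "x > b + 3" if "x \<in> set ys" for x
          using g[OF that] o unfolding gap_rel_def by presburger
        hence "ys \<in> gap_set (b + 3) k (m - 1) (n - int (Suc b))" "m > 0"
          using xs o by (auto simp: gap_set_def ys True sorted_wrt_append)
        thus ?thesis using o ys True by auto
      qed
    qed
  qed
next
  have "?A \<subseteq> gap_set b (Suc k) m n" by (auto simp: gap_set_def)
  moreover have "ys @ [Suc b] \<in> gap_set b (Suc k) m n"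
    if "odd b" "ys \<in> gap_set (b + 2) k m (n - int (Suc b))" for ys
    using that by (fastforce simp: gap_set_def sorted_wrt_append gap_rel_def)
  moreover have "ys @ [Suc b] \<in> gap_set b (Suc k) m n"
    if "even b" "m > 0" "ys \<in> gap_set (b + 3) k (m - 1) (n - int (Suc b))" for ys
  proof -
    have "gap_rel x (Suc b)" if "x \<in> set ys" for x
    proof -
      have "x > b + 3" using that \<open>ys \<in> _\<close> by (simp add: gap_set_def)
      thus ?thesis using \<open>even b\<close> unfolding gap_rel_def by presburger
    qed
    thus ?thesis using that by (fastforce simp: gap_set_def sorted_wrt_append)
  qed
  ultimately show "?A \<union> ?B \<subseteq> gap_set b (Suc k) m n" by auto
qed

lemma card_gap_set_split:
  "card (gap_set b (Suc k) m n) = card (gap_set (Suc b) (Suc k) m n) +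
     (if odd b then card (gap_set (b + 2) k m (n - int (Suc b)))
      else if m > 0 then card (gap_set (b + 3) k (m - 1) (n - int (Suc b))) else 0)"
proof -
  define A where "A = gap_set (Suc b) (Suc k) m n"
  define B where "B = (if odd b then (\<lambda>xs. xs @ [Suc b]) ` gap_set (b + 2) k m (n - int (Suc b))
      else if m > 0 then (\<lambda>xs. xs @ [Suc b]) ` gap_set (b + 3) k (m - 1) (n - int (Suc b)) else {})"
  have "card (gap_set b (Suc k) m n) = card (A \<union> B)"
    unfolding A_def B_def by (rule arg_cong[OF gap_set_split])
  also have "\<dots> = card A + card B"
  proof (rule card_Un_disjoint)
    show "finite A" "finite B" by (auto simp: A_def B_def finite_gap_set)
    have "Suc b \<notin> set xs" if "xs \<in> A" for xs using that by (auto simp: A_def gap_set_def)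
    moreover have "Suc b \<in> set xs" if "xs \<in> B"
      for xs using that by (auto simp: B_def split: if_splits)
    ultimately show "A \<inter> B = {}" by blast
  qed
  also have "card B = (if odd b then card (gap_set (b + 2) k m (n - int (Suc b)))
      else if m > 0 then card (gap_set (b + 3) k (m - 1) (n - int (Suc b))) else 0)"
    unfolding B_def by (auto intro!: card_image simp: inj_on_def)
  finally show ?thesis by (simp add: A_def)
qed

text \<open>A part 1 forces the others above 3; subtracting 2 from them restores threshold 1, and
  the size lost is 1 + 2k.\<close>

lemma card_gap_set_0:
  "card (gap_set 0 (Suc k) m n) = card (gap_set 1 (Suc k) m n) +
     (if m > 0 then card (gap_set 1 k (m - 1) (n - int (2 * k + 1))) else 0)"
proof -
  have e: "n - int (Suc 0) - int (2 * k) = n - int (2 * k + 1)" "(0::nat) + 3 = 1 + 2" "Suc 0 = 1"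
    by simp_all
  show ?thesis
    unfolding card_gap_set_split[of 0] e(2) card_gap_set_lift e(1) unfolding e by simp
qed

text \<open>Splitting at the part 2 gives thresholds 2 and 3, lowered to 0 and 1; both terms lose
  2k+2 in size.\<close>

lemma card_gap_set_1:
  "card (gap_set 1 (Suc k) m n) = card (gap_set 0 (Suc k) m (n - int (2 * k + 2))) +
     card (gap_set 1 k m (n - int (2 * k + 2)))"
proof -
  have e: "n - int (Suc 1) - int (2 * k) = n - int (2 * k + 2)" "n - int (2 * Suc k) = n - int (2 * k + 2)"
    "Suc 1 = 0 + 2" by simp_all
  have "card (gap_set 1 (Suc k) m n) = card (gap_set (0 + 2) (Suc k) m n) + card (gap_set (1 + 2) k m (n - int (Suc 1)))"
    unfolding card_gap_set_split[of 1] e(3) by simp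
  thus ?thesis unfolding card_gap_set_lift e(1,2) .
qed

section \<open>Bivariate generating functions\<close>

text \<open>
  The outer variable is \<open>x\<close>, the inner one \<open>q\<close>. The size is an \<^typ>\<open>int\<close>, so that recurrences may
  subtract from it freely.
\<close>
definition gf :: "(nat \<Rightarrow> int \<Rightarrow> nat) \<Rightarrow> int fps fps" where
  "gf c = Abs_fps (\<lambda>m. Abs_fps (\<lambda>n. int (c m (int n))))"

lemma gf_nth [simp]: "fps_nth (fps_nth (gf c) m) n = int (c m (int n))"
  by (simp add: gf_def)

abbreviation (input) Q :: "int fps fps" where "Q \<equiv> fps_const fps_X"

lemma Q_power_mult_nth:
  "fps_nth (fps_nth (Q ^ d * f) m) n = (if n < d then 0 else fps_nth (fps_nth f m) (n - d))"
  by (simp add: fps_const_power fps_X_power_mult_nth)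

text \<open>The series records only sizes at least 0. For n < d the shifted argument is negative,
  and there \<open>c\<close> has to vanish to match the product with q^d.\<close>

lemma gf_shift:
  assumes "\<And>m n. n < 0 \<Longrightarrow> c m n = 0"
  shows "gf (\<lambda>m n. c m (n - int d)) = Q ^ d * gf c"
proof (intro fps_ext)
  fix m n
  show "fps_nth (fps_nth (gf (\<lambda>m n. c m (n - int d))) m) n = fps_nth (fps_nth (Q ^ d * gf c) m) n"
    unfolding Q_power_mult_nth by (auto simp: assms of_nat_diff)
qed

lemma gf_add: "gf (\<lambda>m n. c m n + d m n) = gf c + gf d"
  by (intro fps_ext) simp

lemma gf_mult_X: "gf (\<lambda>m n. if m > 0 then c (m - 1) n else 0) = fps_X * gf c"
proof (intro fps_ext)
  fix m n
  show "fps_nth (fps_nth (gf (\<lambda>m n. if m > 0 then c (m - 1) n else 0)) m) n = fps_nth (fps_nth (fps_X * gf c) m) n"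
    by simp
qed

lemma gf_one: "gf (\<lambda>m n. if m = 0 \<and> n = 0 then 1 else 0) = 1"
proof (intro fps_ext)
  fix m n
  show "fps_nth (fps_nth (gf (\<lambda>m n. if m = 0 \<and> n = 0 then 1 else 0)) m) n = fps_nth (fps_nth 1 m) n"
    by simp
qed

definition signed_gf :: "nat \<Rightarrow> int fps fps" where "signed_gf k = gf (\<lambda>m n. card (signed_set k m n))"

definition gap_gf :: "nat \<Rightarrow> nat \<Rightarrow> int fps fps" where "gap_gf b k = gf (\<lambda>m n. card (gap_set b k m n))"

lemma signed_gf_0: "signed_gf 0 = 1"
  unfolding signed_gf_def gf_one[symmetric] by (intro arg_cong[where f = gf] ext) (simp add: signed_set_0)

lemma gap_gf_0: "gap_gf b 0 = 1"
  unfolding gap_gf_def gf_one[symmetric] by (intro arg_cong[where f = gf] ext) (simp add: gap_set_0)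

lemma signed_gf_Suc:
  "signed_gf (Suc k) = Q ^ (2 * k + 2) * signed_gf (Suc k) + Q ^ (2 * k + 2) * signed_gf k +
     (if even k then fps_X * Q * signed_gf k else 0)"
proof -
  let ?c = "\<lambda>k m n. card (signed_set k m n)"
  have 0: "?c k m n = 0" if "n < 0" for k m n using that by (simp add: signed_set_empty)
  have h: "gf (\<lambda>m n. if m > 0 then ?c k (m - 1) (n - int 1) else 0) = fps_X * (Q ^ 1 * gf (?c k))"
    unfolding gf_mult_X[of "\<lambda>m n. ?c k m (n - int 1)"] by (subst gf_shift[where d = 1, symmetric]) (simp_all add: 0)
  have 1: "gf (\<lambda>m n. if even k \<and> m > 0 then ?c k (m - 1) (n - 1) else 0) = (if even k then fps_X * Q * gf (?c k) else 0)"
  proof (cases "even k")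
    case True
    thus ?thesis using h by (simp only: simp_thms of_nat_1 power_one_right mult.assoc if_True)
  qed (simp add: gf_def fps_eq_iff)
  have "signed_gf (Suc k) = gf (\<lambda>m n. ?c (Suc k) m (n - int (2 * k + 2)) + ?c k m (n - int (2 * k + 2)) +
     (if even k \<and> m > 0 then ?c k (m - 1) (n - 1) else 0))"
    unfolding signed_gf_def by (intro arg_cong[where f = gf] ext card_signed_set_Suc)
  also have "\<dots> = Q ^ (2 * k + 2) * gf (?c (Suc k)) + Q ^ (2 * k + 2) * gf (?c k) +
     (if even k then fps_X * Q * gf (?c k) else 0)"
    unfolding gf_add 1 by (subst (1 2) gf_shift) (simp_all add: 0)
  finally show ?thesis unfolding signed_gf_def .
qed

lemma gap_gf_Suc_0: "gap_gf 0 (Suc k) = gap_gf 1 (Suc k) + fps_X * Q ^ (2 * k + 1) * gap_gf 1 k"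
proof -
  let ?c = "\<lambda>b k m n. card (gap_set b k m n)"
  have 0: "?c b k m n = 0" if "n < 0" for b k m n using that by (simp add: gap_set_empty)
  have "gap_gf 0 (Suc k) = gf (\<lambda>m n. ?c 1 (Suc k) m n + (if m > 0 then ?c 1 k (m - 1) (n - int (2 * k + 1)) else 0))"
    unfolding gap_gf_def by (intro arg_cong[where f = gf] ext card_gap_set_0)
  also have "\<dots> = gf (?c 1 (Suc k)) + fps_X * gf (\<lambda>m n. ?c 1 k m (n - int (2 * k + 1)))"
    unfolding gf_add gf_mult_X[of "\<lambda>m n. ?c 1 k m (n - int (2 * k + 1))"] ..
  also have "gf (\<lambda>m n. ?c 1 k m (n - int (2 * k + 1))) = Q ^ (2 * k + 1) * gf (?c 1 k)"
    by (rule gf_shift) (rule 0)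
  finally show ?thesis unfolding gap_gf_def by (simp only: mult.assoc)
qed

lemma gap_gf_Suc_1: "gap_gf 1 (Suc k) = Q ^ (2 * k + 2) * gap_gf 0 (Suc k) + Q ^ (2 * k + 2) * gap_gf 1 k"
proof -
  let ?c = "\<lambda>b k m n. card (gap_set b k m n)"
  have 0: "?c b k m n = 0" if "n < 0" for b k m n using that by (simp add: gap_set_empty)
  have "gap_gf 1 (Suc k) = gf (\<lambda>m n. ?c 0 (Suc k) m (n - int (2 * k + 2)) + ?c 1 k m (n - int (2 * k + 2)))"
    unfolding gap_gf_def by (intro arg_cong[where f = gf] ext card_gap_set_1)
  also have "\<dots> = Q ^ (2 * k + 2) * gf (?c 0 (Suc k)) + Q ^ (2 * k + 2) * gf (?c 1 k)"
    unfolding gf_add by (intro arg_cong2[where f = "(+)"] gf_shift 0)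
  finally show ?thesis unfolding gap_gf_def .
qed

section \<open>Telescoped functional equations\<close>

text \<open>\<open>T'\<close> stands for \<open>T\<close> with x q^4 in place of x. As the
  recurrence depends on the parity of k, the sums advance by two terms at a time.\<close>

lemma signed_telescope:
  fixes q x :: "'a :: idom" and T T' :: "nat \<Rightarrow> 'a"
  assumes nz: "\<And>k. k > 0 \<Longrightarrow> q ^ k \<noteq> 1"
    and T0: "T 0 = 1"
    and T: "\<And>k. T (Suc k) = q ^ (2 * k + 2) * T (Suc k) + q ^ (2 * k + 2) * T k +
      (if even k then x * q * T k else 0)"
    and T'0: "T' 0 = 1"
    and T': "\<And>k. T' (Suc k) = q ^ (2 * k + 2) * T' (Suc k) + q ^ (2 * k + 2) * T' k +
      (if even k then x * q ^ 4 * q * T' k else 0)"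
  shows "(\<Sum>k\<le>2 * M. T k) + x * q * T (2 * M) = (1 + x * q) * (\<Sum>k\<le>2 * M. T' k)"
proof -
  have nz24: "1 - q ^ (4 * j) * q ^ 2 \<noteq> 0" "1 - q ^ (4 * j) * q ^ 4 \<noteq> 0" for j
    using nz[of "4 * j + 2"] nz[of "4 * j + 4"] unfolding power_add by auto
  have e: "2 * (2 * j) + 2 = 4 * j + 2" "2 * (2 * j + 1) + 2 = 4 * j + 4" for j :: nat by auto
  have T1: "(1 - q ^ (4 * j) * q ^ 2) * T (2 * j + 1) = (q ^ (4 * j) * q ^ 2 + x * q) * T (2 * j)"
    for j
    using T[of "2 * j"] unfolding e power_add by (simp add: algebra_simps)
  have T2: "(1 - q ^ (4 * j) * q ^ 4) * T (2 * j + 2) = q ^ (4 * j) * q ^ 4 * T (2 * j + 1)" for j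
    using T[of "2 * j + 1"] unfolding e power_add by (simp add: algebra_simps)
  have T'1: "(1 - q ^ (4 * j) * q ^ 2) * T' (2 * j + 1) = (q ^ (4 * j) * q ^ 2 + x * q ^ 4 * q) * T' (2 * j)"
    for j
    using T'[of "2 * j"] unfolding e power_add by (simp add: algebra_simps)
  have T'2: "(1 - q ^ (4 * j) * q ^ 4) * T' (2 * j + 2) = q ^ (4 * j) * q ^ 4 * T' (2 * j + 1)"
    for j
    using T'[of "2 * j + 1"] unfolding e power_add by (simp add: algebra_simps)
  \<comment> \<open>The induction step of \<open>shift\<close> below, with p for q^(4j), multiplied
    by both denominators.\<close>
  have ring1: "(1 - p * q ^ 2) * ((1 - p * q ^ 4) * ((p * q ^ 4 + x * q ^ 3) * t2')) =
        (1 - p * q ^ 2) * ((1 - p * q ^ 4) * (p * q ^ 4 * (1 + x * q ^ 3) * t2))"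
    if t: "(1 - p * q ^ 2) * t1 = (p * q ^ 2 + x * q) * t0" "(1 - p * q ^ 4) * t2 = p * q ^ 4 * t1"
      "(1 - p * q ^ 2) * t1' = (p * q ^ 2 + x * q ^ 4 * q) * t0'" "(1 - p * q ^ 4) * t2' = p * q ^ 4 * t1'"
      and sh: "(p + x * q ^ 3) * t0' = p * (1 + x * q ^ 3) * t0" for p t0 t1 t2 t0' t1' t2'
  proof -
    have "(1 - p * q ^ 2) * ((1 - p * q ^ 4) * ((p * q ^ 4 + x * q ^ 3) * t2')) =
        (p * q ^ 4 + x * q ^ 3) * ((1 - p * q ^ 2) * ((1 - p * q ^ 4) * t2'))"
          by (simp add: mult_ac)
    also have "\<dots> = (p * q ^ 4 + x * q ^ 3) * (p * q ^ 4 * ((1 - p * q ^ 2) * t1'))"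
      unfolding t(4) by (simp add: mult_ac)
    also have "\<dots> = (p * q ^ 4 + x * q ^ 3) * (p * q ^ 4 * (q ^ 2 * ((p + x * q ^ 3) * t0')))"
      unfolding t(3) by algebra
    also have "\<dots> = p * q ^ 4 * (1 + x * q ^ 3) * (p * q ^ 4 * ((p * q ^ 2 + x * q) * t0))"
      unfolding sh by algebra
    also have "\<dots> = p * q ^ 4 * (1 + x * q ^ 3) * ((1 - p * q ^ 2) * ((1 - p * q ^ 4) * t2))"
      unfolding t(2) t(1)[symmetric] by (simp add: mult_ac)
    finally show ?thesis by (simp add: mult_ac)
  qed
  \<comment> \<open>From 2j to 2j+2 the growth factors of \<open>T'\<close> and \<open>T\<close>
    have quotient q^4 (p + x q^3) / (p q^4 + x q^3) with p = q^(4j). Their product telescopes to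
    this relation.\<close>
  have shift: "(q ^ (4 * j) + x * q ^ 3) * T' (2 * j) = q ^ (4 * j) * (1 + x * q ^ 3) * T (2 * j)"
    for j
  proof (induction j)
    case 0 show ?case by (simp add: T0 T'0)
  next
    case (Suc j)
    have "(q ^ (4 * j) * q ^ 4 + x * q ^ 3) * T' (2 * j + 2) = q ^ (4 * j) * q ^ 4 * (1 + x * q ^ 3) * T (2 * j + 2)"
      using ring1[OF T1 T2 T'1 T'2 Suc.IH] nz24[of j] by simp
    moreover have "q ^ (4 * Suc j) = q ^ (4 * j) * q ^ 4" by (simp add: power_add mult.commute)
    ultimately show ?case by simp
  qed
  \<comment> \<open>The increments of the two sides of the claim when M grows by one, again cleared
    of denominators.\<close>
  have ring2: "(1 - p * q ^ 2) * ((1 - p * q ^ 4) * (t1 + t2 + x * q * t2 - x * q * t0)) =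
          (1 - p * q ^ 2) * ((1 - p * q ^ 4) * ((1 + x * q) * (t1' + t2')))"
    if t: "(1 - p * q ^ 2) * t1 = (p * q ^ 2 + x * q) * t0" "(1 - p * q ^ 4) * t2 = p * q ^ 4 * t1"
      "(1 - p * q ^ 2) * t1' = (p * q ^ 2 + x * q ^ 4 * q) * t0'" "(1 - p * q ^ 4) * t2' = p * q ^ 4 * t1'"
      and sh: "(p + x * q ^ 3) * t0' = p * (1 + x * q ^ 3) * t0" for p t0 t1 t2 t0' t1' t2'
  proof -
    have "(1 - p * q ^ 2) * ((1 - p * q ^ 4) * (t1 + t2 + x * q * t2 - x * q * t0)) =
       (1 - p * q ^ 4) * ((1 - p * q ^ 2) * t1) + (1 + x * q) * (1 - p * q ^ 2) * ((1 - p * q ^ 4) * t2)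
         - x * q * (1 - p * q ^ 2) * (1 - p * q ^ 4) * t0" by algebra
    also have "\<dots> = (1 - p * q ^ 4) * ((1 - p * q ^ 2) * t1) + (1 + x * q) * (p * q ^ 4) * ((1 - p * q ^ 2) * t1)
         - x * q * (1 - p * q ^ 2) * (1 - p * q ^ 4) * t0" unfolding t(2) by algebra
    \<comment> \<open>The coefficient of \<open>t0\<close> collapses to p q^2 (1 + x q) (1 + x q^3),
      which is where the factor 1 + x q appears and \<open>sh\<close> becomes applicable.\<close>
    also have "\<dots> = (1 + x * q) * (q ^ 2 * (p * (1 + x * q ^ 3) * t0))"
      unfolding t(1) by algebra
    also have "\<dots> = (1 + x * q) * ((1 - p * q ^ 2) * t1')"
      unfolding t(3) sh[symmetric] by algebra
    also have "\<dots> = (1 + x * q) * (1 - p * q ^ 2) * ((1 - p * q ^ 4) * t1' + p * q ^ 4 * t1')"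
      by algebra
    also have "\<dots> = (1 - p * q ^ 2) * ((1 - p * q ^ 4) * ((1 + x * q) * (t1' + t2')))"
      unfolding t(4)[symmetric] by algebra
    finally show ?thesis .
  qed
  show ?thesis
  proof (induction M)
    case 0 show ?case by (simp add: T0 T'0)
  next
    case (Suc M)
    have step: "T (2 * M + 1) + T (2 * M + 2) + x * q * T (2 * M + 2) - x * q * T (2 * M) =
        (1 + x * q) * (T' (2 * M + 1) + T' (2 * M + 2))"
      using ring2[OF T1 T2 T'1 T'2 shift, of M] nz24[of M] by simp
    have split: "(\<Sum>k\<le>2 * Suc M. f k) = (\<Sum>k\<le>2 * M. f k) + (f (2 * M + 1) + f (2 * M + 2))"
      for f :: "nat \<Rightarrow> 'a"
      by (simp add: add.assoc)
    have "(\<Sum>k\<le>2 * Suc M. T k) + x * q * T (2 * Suc M) =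
        ((\<Sum>k\<le>2 * M. T k) + x * q * T (2 * M)) +
        (T (2 * M + 1) + T (2 * M + 2) + x * q * T (2 * M + 2) - x * q * T (2 * M))"
      unfolding split by simp
    also have "\<dots> = (1 + x * q) * (\<Sum>k\<le>2 * Suc M. T' k)"
      unfolding Suc.IH step split by (rule distrib_left[symmetric])
    finally show ?case .
  qed
qed

text \<open>From K to K+1 the old correction term cancels the last summand of
  \<open>F (Suc K)\<close>, so the left side grows by (1 + x q^(2K+3)) \<open>H (Suc K)\<close>. By
  \<open>rel\<close> this is (1 + x q) \<open>F' (Suc K)\<close>.\<close>

lemma gap_telescope:
  fixes q x :: "'a :: idom" and F H F' H' :: "nat \<Rightarrow> 'a"
  assumes nz: "\<And>k. k > 0 \<Longrightarrow> q ^ k \<noteq> 1"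
    and F0: "F 0 = 1" and H0: "H 0 = 1" and F'0: "F' 0 = 1" and H'0: "H' 0 = 1"
    and F: "\<And>k. F (Suc k) = H (Suc k) + x * q ^ (2 * k + 1) * H k"
    and H: "\<And>k. H (Suc k) = q ^ (2 * k + 2) * F (Suc k) + q ^ (2 * k + 2) * H k"
    and F': "\<And>k. F' (Suc k) = H' (Suc k) + x * q ^ 4 * q ^ (2 * k + 1) * H' k"
    and H': "\<And>k. H' (Suc k) = q ^ (2 * k + 2) * F' (Suc k) + q ^ (2 * k + 2) * H' k"
  shows "(\<Sum>k\<le>K. F k) + x * q ^ (2 * K + 1) * H K = (1 + x * q) * (\<Sum>k\<le>K. F' k)"
proof -
  have nz2: "1 - q ^ (2 * k) * q ^ 2 \<noteq> 0" for k
    using nz[of "2 * k + 2"] unfolding power_add by auto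
  \<comment> \<open>Solves the mutual recurrence for \<open>f1\<close> and \<open>h1\<close> in
    terms of \<open>h0\<close>; here p is q^(2k), and y is x or x q^4.\<close>
  have fh: "(1 - p * q ^ 2) * f1 = (p * q ^ 2 + y * p * q) * h0" "(1 - p * q ^ 2) * h1 = p * q ^ 2 * (1 + y * p * q) * h0"
    if "f1 = h1 + y * (p * q) * h0" "h1 = p * q ^ 2 * f1 + p * q ^ 2 * h0" for p y f1 h0 h1
  proof -
    have "f1 - p * q ^ 2 * f1 = h1 + y * (p * q) * h0 - p * q ^ 2 * f1" using that(1) by simp
    also have "\<dots> = p * q ^ 2 * h0 + y * (p * q) * h0" using that(2) by simp
    finally show "(1 - p * q ^ 2) * f1 = (p * q ^ 2 + y * p * q) * h0" by (simp add: algebra_simps)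
    have "h1 - p * q ^ 2 * h1 = p * q ^ 2 * f1 + p * q ^ 2 * h0 - p * q ^ 2 * h1"
      using that(2) by simp
    also have "\<dots> = p * q ^ 2 * (1 + y * p * q) * h0" unfolding that(1) by algebra
    finally show "(1 - p * q ^ 2) * h1 = p * q ^ 2 * (1 + y * p * q) * h0"
      by (simp add: algebra_simps)
  qed
  have e: "q ^ (2 * k + 1) = q ^ (2 * k) * q" "q ^ (2 * k + 2) = q ^ (2 * k) * q ^ 2" "q ^ (2 * Suc k) = q ^ (2 * k) * q ^ 2"
    for k
    by (simp_all add: power2_eq_square mult_ac)
  note FH = fh[OF F[unfolded e] H[unfolded e]]
  note FH' = fh[OF F'[unfolded e] H'[unfolded e]]
  \<comment> \<open>For k > 0 both sequences are explicit multiples of the preceding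
    \<open>H'\<close>, so their ratio is known.\<close>
  have rel': "(1 + x * q ^ 3) * H' k = (1 + x * q ^ 3 * q ^ (2 * k)) * F' k" for k
  proof (cases k)
    case 0 thus ?thesis by (simp add: F'0 H'0)
  next
    case (Suc j)
    define p where "p = q ^ (2 * j)"
    have "(1 - p * q ^ 2) * ((1 + x * q ^ 3) * H' (Suc j)) = (1 + x * q ^ 3) * ((1 - p * q ^ 2) * H' (Suc j))"
      by (simp add: mult_ac)
    also have "\<dots> = (1 + x * q ^ 3 * (p * q ^ 2)) * ((1 - p * q ^ 2) * F' (Suc j))"
      unfolding FH'[of j, folded p_def] by algebra
    finally have "(1 - p * q ^ 2) * ((1 + x * q ^ 3) * H' (Suc j)) = (1 - p * q ^ 2) * ((1 + x * q ^ 3 * (p * q ^ 2)) * F' (Suc j))"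
      by (simp add: mult_ac)
    thus ?thesis unfolding Suc e using nz2[of j] unfolding p_def by simp
  qed
  have rel: "(1 + x * q) * F' k = (1 + x * q * q ^ (2 * k)) * H k" for k
  proof (induction k)
    case 0 show ?case by (simp add: F'0 H0)
  next
    case (Suc k)
    define p where "p = q ^ (2 * k)"
    have "(1 - p * q ^ 2) * ((1 + x * q) * F' (Suc k)) = (1 + x * q) * ((1 - p * q ^ 2) * F' (Suc k))"
      by (simp add: mult_ac)
    also have "\<dots> = p * q ^ 2 * (1 + x * q) * ((1 + x * q ^ 3) * H' k)"
      unfolding FH'(1)[of k, folded p_def] by algebra
    also have "\<dots> = p * q ^ 2 * (1 + x * q ^ 3 * p) * ((1 + x * q) * F' k)"
      unfolding rel' p_def[symmetric] by (simp add: mult_ac)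
    also have "\<dots> = (1 + x * q * (p * q ^ 2)) * ((1 - p * q ^ 2) * H (Suc k))"
      unfolding Suc.IH FH(2)[of k, folded p_def] p_def[symmetric] by algebra
    finally have "(1 - p * q ^ 2) * ((1 + x * q) * F' (Suc k)) = (1 - p * q ^ 2) * ((1 + x * q * (p * q ^ 2)) * H (Suc k))"
      by (simp add: mult_ac)
    thus ?case unfolding e using nz2[of k] unfolding p_def by simp
  qed
  show ?thesis
  proof (induction K)
    case 0 show ?case by (simp add: F0 F'0 H0)
  next
    case (Suc K)
    show ?case using Suc.IH F[of K] rel[of "Suc K"] by (simp add: algebra_simps)
  qed
qed

section \<open>Substitution of x q^4 for x\<close>

definition scale :: "int fps fps \<Rightarrow> int fps fps" where
  "scale f = f oo (fps_const (fps_X ^ 4) * fps_X)"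

text \<open>Since x^m acquires q^(4m), for m > 0 a coefficient of \<open>scale f\<close> involves
  only strictly smaller sizes of \<open>f\<close>; this drives the final induction.\<close>

lemma scale_nth: "fps_nth (fps_nth (scale f) m) n = (if n < 4 * m then 0 else fps_nth (fps_nth f m) (n - 4 * m))"
  unfolding scale_def fps_compose_linear by (simp add: fps_X_power_mult_nth flip: power_mult)

lemma scale_simps:
  "scale (f + g) = scale f + scale g" "scale (f * g) = scale f * scale g" "scale 1 = 1" "scale 0 = 0"
  "scale (Q ^ d) = Q ^ d" "scale Q = Q" "scale fps_X = fps_X * Q ^ 4"
  by (simp_all add: scale_def fps_compose_add_distrib fps_compose_mult_distrib fps_const_power mult.commute)

lemma scale_sum: "scale (\<Sum>k\<in>A. f k) = (\<Sum>k\<in>A. scale (f k))"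
  by (simp add: scale_def fps_compose_sum_distrib)

lemma Q_power_neq_1: "k > 0 \<Longrightarrow> Q ^ k \<noteq> 1"
proof
  assume "k > 0" "Q ^ k = 1"
  hence "fps_nth (fps_nth (Q ^ k) 0) 0 = fps_nth (fps_nth 1 0) 0" by simp
  thus False using \<open>k > 0\<close> by (simp add: fps_const_power)
qed

lemma signed_gf_scale:
  "(\<Sum>k\<le>2 * M. signed_gf k) + fps_X * Q * signed_gf (2 * M) = (1 + fps_X * Q) * scale (\<Sum>k\<le>2 * M. signed_gf k)"
  unfolding scale_sum
proof (rule signed_telescope)
  show "scale (signed_gf (Suc k)) = Q ^ (2 * k + 2) * scale (signed_gf (Suc k)) + Q ^ (2 * k + 2) * scale (signed_gf k) +
    (if even k then fps_X * Q ^ 4 * Q * scale (signed_gf k) else 0)" for k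
    by (subst signed_gf_Suc, cases "even k") (simp_all only: scale_simps if_True if_False)
  show "signed_gf 0 = 1" "scale (signed_gf 0) = 1" by (simp_all add: signed_gf_0 scale_simps)
qed (fact Q_power_neq_1 signed_gf_Suc)+

lemma gap_gf_scale:
  "(\<Sum>k\<le>K. gap_gf 0 k) + fps_X * Q ^ (2 * K + 1) * gap_gf 1 K = (1 + fps_X * Q) * scale (\<Sum>k\<le>K. gap_gf 0 k)"
  unfolding scale_sum
proof (rule gap_telescope[where H' = "\<lambda>k. scale (gap_gf 1 k)"])
  show "scale (gap_gf 0 (Suc k)) = scale (gap_gf 1 (Suc k)) + fps_X * Q ^ 4 * Q ^ (2 * k + 1) * scale (gap_gf 1 k)"
    for k
    unfolding gap_gf_Suc_0 scale_simps ..
  show "scale (gap_gf 1 (Suc k)) = Q ^ (2 * k + 2) * scale (gap_gf 0 (Suc k)) + Q ^ (2 * k + 2) * scale (gap_gf 1 k)"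
    for k
    unfolding gap_gf_Suc_1 scale_simps ..
  show "gap_gf 0 0 = 1" "gap_gf 1 0 = 1" "scale (gap_gf 0 0) = 1" "scale (gap_gf 1 0) = 1"
    by (simp_all add: gap_gf_0 scale_simps)
qed (fact Q_power_neq_1 gap_gf_Suc_0 gap_gf_Suc_1)+

section \<open>Comparison of coefficients\<close>

text \<open>Distinct even parts automatically differ by at least 2, and the condition on odd
  neighbours is then vacuous. This is the comparison at x = 0.\<close>

lemma card_signed_set_no_neg: "card (signed_set k 0 n) = card (gap_set 0 k 0 n)"
proof -
  have "sorted_wrt (>) xs \<longleftrightarrow> sorted_wrt gap_rel xs" if "\<forall>x\<in>set xs. even x"
    for xs
  proof
    assume "sorted_wrt (>) xs"
    thus "sorted_wrt gap_rel xs"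
    proof (rule sorted_wrt_mono_rel[rotated])
      fix x y assume "x \<in> set xs" "y \<in> set xs" "x > y"
      moreover from this have "even x" "even y" using that by blast+
      ultimately show "gap_rel x y" unfolding gap_rel_def by presburger
    qed
  next
    assume "sorted_wrt gap_rel xs"
    thus "sorted_wrt (>) xs" by (rule sorted_wrt_mono_rel[rotated]) (simp add: gap_rel_def)
  qed
  hence "signed_set k 0 n = (\<lambda>\<pi>. (\<pi>, [])) ` gap_set 0 k 0 n"
    by (auto simp: signed_set_def gap_set_def signed_pair_def filter_empty_conv)
  thus ?thesis by (simp add: card_image inj_on_def)
qed

text \<open>Up to q-order 2M the correction terms of the telescoped equations vanish, so both sums
  obey the same coefficient recurrence and agree once they agree at m = 0.\<close>

lemma sum_card_signed_eq_gap:
  assumes "n \<le> 2 * M"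
  shows "(\<Sum>k\<le>2 * M. card (signed_set k m (int n))) = (\<Sum>k\<le>2 * M. card (gap_set 0 k m (int n)))"
proof -
  define S where "S = (\<Sum>k\<le>2 * M. signed_gf k)"
  define G where "G = (\<Sum>k\<le>2 * M. gap_gf 0 k)"
  have S: "fps_nth (fps_nth S m) n = int (\<Sum>k\<le>2 * M. card (signed_set k m (int n)))" for m n
    by (simp add: S_def signed_gf_def fps_sum_nth)
  have G: "fps_nth (fps_nth G m) n = int (\<Sum>k\<le>2 * M. card (gap_set 0 k m (int n)))" for m n
    by (simp add: G_def gap_gf_def fps_sum_nth)
  have XQ: "fps_nth (fps_nth (fps_X * Q ^ d * f) m) n =
      (if m = 0 \<or> n < d then 0 else fps_nth (fps_nth f (m - 1)) (n - d))" for d f m n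
    unfolding mult.assoc by (simp add: fps_X_power_mult_nth)
  have rec: "fps_nth (fps_nth f m) n = fps_nth (fps_nth (scale f) m) n +
       (if m = 0 \<or> n = 0 then 0 else fps_nth (fps_nth (scale f) (m - 1)) (n - 1))"
    if "f + r = (1 + fps_X * Q) * scale f" "fps_nth (fps_nth r m) n = 0" for f r m n
  proof -
    have "fps_nth (fps_nth (f + r) m) n = fps_nth (fps_nth (scale f + fps_X * Q ^ 1 * scale f) m) n"
      unfolding that(1) by (simp add: distrib_right)
    thus ?thesis using that(2) unfolding fps_add_nth XQ by simp
  qed
  have recS: "fps_nth (fps_nth S m) n = fps_nth (fps_nth (scale S) m) n +
       (if m = 0 \<or> n = 0 then 0 else fps_nth (fps_nth (scale S) (m - 1)) (n - 1))" if "n \<le> 2 * M"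
         for m n
  proof (rule rec)
    show "S + fps_X * Q ^ 1 * signed_gf (2 * M) = (1 + fps_X * Q) * scale S"
      using signed_gf_scale[of M] by (simp add: S_def)
    \<comment> \<open>The coefficient would count signed partitions of n - 1 with 2M > n - 1
      positive parts.\<close>
    show "fps_nth (fps_nth (fps_X * Q ^ 1 * signed_gf (2 * M)) m) n = 0"
      unfolding XQ using that by (simp add: signed_gf_def signed_set_empty)
  qed
  have recG: "fps_nth (fps_nth G m) n = fps_nth (fps_nth (scale G) m) n +
       (if m = 0 \<or> n = 0 then 0 else fps_nth (fps_nth (scale G) (m - 1)) (n - 1))" if "n \<le> 2 * M"
         for m n
  proof (rule rec)
    show "G + fps_X * Q ^ (2 * (2 * M) + 1) * gap_gf 1 (2 * M) = (1 + fps_X * Q) * scale G"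
      using gap_gf_scale[of "2 * M"] by (simp only: G_def)
    show "fps_nth (fps_nth (fps_X * Q ^ (2 * (2 * M) + 1) * gap_gf 1 (2 * M)) m) n = 0"
      unfolding XQ using that by simp
  qed
  have "fps_nth (fps_nth S m) n = fps_nth (fps_nth G m) n" if "n \<le> 2 * M" for m n
    using that
  proof (induction m arbitrary: n)
    case 0
    show ?case unfolding S G by (simp add: card_signed_set_no_neg)
  next
    case (Suc m)
    note IHm = Suc.IH
    from Suc.prems show ?case
    proof (induction n rule: less_induct)
      case (less n)
      \<comment> \<open>The recurrence leads to x-degree \<open>Suc m\<close> at a smaller size,
        covered by the inner induction, and to x-degree m, covered by the outer one.\<close>
      show ?case
        unfolding recS[OF less.prems] recG[OF less.prems] scale_nth
        using less IHm by simp
    qed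
  qed
  from this[OF assms, of m] show ?thesis unfolding S G of_nat_eq_iff .
qed

section \<open>Summation over both statistics\<close>

lemma card_Union_two_stats:
  assumes "\<And>k m. finite (B k m)" "\<And>k m k' m'. B k m \<inter> B k' m' \<noteq> {} \<Longrightarrow> k = k' \<and> m = m'"
    and "A = (\<Union>m\<le>K. \<Union>k\<le>K. B k m)"
  shows "card A = (\<Sum>m\<le>K. \<Sum>k\<le>(K::nat). card (B k m))"
proof -
  have d: "B k m \<inter> B k' m' = {}" if "k \<noteq> k' \<or> m \<noteq> m'" for k m k' m'
    using assms(2)[of k m k' m'] that by argo
  have "card (\<Union>k\<le>K. B k m) = (\<Sum>k\<le>K. card (B k m))" for m
    by (rule card_UN_disjoint) (simp_all add: assms(1) d)
  moreover have "card A = (\<Sum>m\<le>K. card (\<Union>k\<le>K. B k m))"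
    unfolding assms(3) by (rule card_UN_disjoint) (simp_all add: assms(1) d Int_UN_distrib2)
  ultimately show ?thesis by simp
qed

lemma sorted_wrt_greater_iff: "sorted_wrt (>) xs \<longleftrightarrow> sorted_wrt (\<ge>) xs \<and> distinct (xs :: nat list)"
  by (induction xs) (fastforce simp: le_less)+

theorem theorem5p4:
  fixes n :: nat
  shows "LG_1 n = LG'_minus_1 n"
proof -
  have trans: "transp gap_rel" by (auto simp: transp_def gap_rel_def)
  have ge: "sorted_wrt (\<ge>) xs" if "sorted_wrt gap_rel xs" for xs
    using that by (rule sorted_wrt_mono_rel[rotated]) (simp add: gap_rel_def)
  have "length xs \<le> sum_list xs" if "\<forall>x\<in>set xs. x > 0" for xs :: "nat list"
    using that by (induction xs) auto
  hence len: "length xs \<le> n" if "\<forall>x\<in>set xs. x > 0" "sum_list xs = n"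
    for xs using that by blast
  \<comment> \<open>Both statistics are at most n, so they lie in the range up to 2n, the even limit
    2M for M = n.\<close>
  have gap: "{xs. partition_of n xs \<and> (\<forall>i. Suc i < length xs \<longrightarrow> xs ! i \<ge> xs ! Suc i + 2 \<and>
        (odd (xs ! i) \<and> odd (xs ! Suc i) \<longrightarrow> xs ! i \<ge> xs ! Suc i + 4))} =
     (\<Union>m\<le>2 * n. \<Union>k\<le>2 * n. gap_set 0 k m (int n))"
    (is "?L = ?R")
  proof (intro set_eqI iffI)
    fix xs assume "xs \<in> ?L"
    hence x: "sorted_wrt gap_rel xs" "\<forall>x\<in>set xs. x > 0" "sum_list xs = n"
      by (auto simp: partition_of_def is_partition_def sorted_wrt_iff_nth_Suc_transp[OF trans] gap_rel_def)
    moreover have "length (filter odd xs) \<le> n"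
      using length_filter_le len[OF x(2,3)] by (rule le_trans)
    ultimately show "xs \<in> ?R" using len[of xs] by (auto simp: gap_set_def)
  next
    fix xs assume "xs \<in> ?R"
    hence x: "sorted_wrt gap_rel xs" "\<forall>x\<in>set xs. x > 0" "sum_list xs = n"
      by (auto simp: gap_set_def)
    moreover note ge[OF x(1)]
    ultimately show "xs \<in> ?L"
      by (auto simp: partition_of_def is_partition_def sorted_wrt_iff_nth_Suc_transp[OF trans] gap_rel_def)
  qed
  have "LG_1 n = (\<Sum>m\<le>2 * n. \<Sum>k\<le>2 * n. card (gap_set 0 k m (int n)))"
    unfolding LG_1_def by (rule card_Union_two_stats[OF finite_gap_set _ gap]) (auto simp: gap_set_def)
  also have "\<dots> = (\<Sum>m\<le>2 * n. \<Sum>k\<le>2 * n. card (signed_set k m (int n)))"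
    by (intro sum.cong refl sum_card_signed_eq_gap[symmetric]) simp
  also have "\<dots> = LG'_minus_1 n"
    unfolding LG'_minus_1_def
  proof (intro card_Union_two_stats[symmetric])
    show "{(\<pi>, \<nu>). signed_partition_of (int n) (\<pi>, \<nu>) \<and>
     distinct \<pi> \<and> (\<forall>x \<in> set \<pi>. even x) \<and>
     distinct \<nu> \<and> (\<forall>y \<in> set \<nu>. y mod 4 = 1 \<and> y \<le> 2 * length \<pi>)} =
     (\<Union>m\<le>2 * n. \<Union>k\<le>2 * n. signed_set k m (int n))" (is "?L = ?R")
    proof (intro set_eqI iffI)
      fix p assume "p \<in> ?L"
      moreover obtain \<pi> \<nu> where p: "p = (\<pi>, \<nu>)" by (cases p)
      ultimately have s: "signed_pair \<pi> \<nu>" "int (sum_list \<pi>) - int (sum_list \<nu>) = int n"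
        by (auto simp: signed_partition_of_def is_partition_def signed_pair_def sorted_wrt_greater_iff)
      \<comment> \<open>There are at most n positive parts and no more negative than positive
        ones.\<close>
      thus "p \<in> ?R" using signed_pair_bounds[OF s(1)] by (auto simp: p signed_set_def)
    next
      fix p assume "p \<in> ?R"
      thus "p \<in> ?L"
        by (fastforce simp: signed_set_def signed_partition_of_def is_partition_def signed_pair_def sorted_wrt_greater_iff)
    qed
  qed (rule finite_signed_set, auto simp: signed_set_def)
  finally show ?thesis .
qed
end
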